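(* Let $d_e,d_r$ be positive integers and let $\mathcal{W}\in\mathbb{R}^{d_e\times d_r\times d_e}$ be the core tensor of a TuckER model with entity embedding dimension $d_e$ and relation embedding dimension $d_r$. Then there exist a positive integer $k\le\min(d_e,d_r)$ and a LowFER model with factorization rank $k$, entity embedding dimension $d_e$ and relation embedding dimension $d_r$, i.e. matrices $\mathbf{U}\in\mathbb{R}^{d_e\times kd_e}$ and $\mathbf{V}\in\mathbb{R}^{d_r\times kd_e}$, that accurately represents the TuckER model: for all $\mathbf{e}_s,\mathbf{e}_o\in\mathbb{R}^{d_e}$ and $\mathbf{r}\in\mathbb{R}^{d_r}$, $$\bigl(\mathbf{S}^k\,\mathrm{diag}(\mathbf{U}^T\mathbf{e}_s)\,\mathbf{V}^T\mathbf{r}\bigr)^T\mathbf{e}_o=\mathcal{W}\times_1\mathbf{e}_s\times_2\mathbf{r}\times_3\mathbf{e}_o .$$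
   Context: TuckER model. With core tensor $\mathcal{W}\in\mathbb{R}^{d_e\times d_r\times d_e}$, the TuckER score of a subject entity vector $\mathbf{e}_s\in\mathbb{R}^{d_e}$, relation vector $\mathbf{r}\in\mathbb{R}^{d_r}$ and object entity vector $\mathbf{e}_o\in\mathbb{R}^{d_e}$ is $\mathcal{W}\times_1\mathbf{e}_s\times_2\mathbf{r}\times_3\mathbf{e}_o=\sum_{a=1}^{d_e}\sum_{b=1}^{d_r}\sum_{c=1}^{d_e}\mathcal{W}_{abc}(\mathbf{e}_s)_a\,\mathbf{r}_b\,(\mathbf{e}_o)_c$, where $\times_n$ is the tensor product along the $n$-th mode. LowFER model. With factorization rank $k\ge1$ and parameters $\mathbf{U}\in\mathbb{R}^{d_e\times kd_e}$, $\mathbf{V}\in\mathbb{R}^{d_r\times kd_e}$, the LowFER score is $f=\bigl(\mathbf{S}^k\,\mathrm{diag}(\mathbf{U}^T\mathbf{e}_s)\,\mathbf{V}^T\mathbf{r}\bigr)^T\mathbf{e}_o$, where $\mathbf{S}^k\in\mathbb{R}^{d_e\times kd_e}$ has entries $\mathbf{S}^k_{i,j}=1$ if $(i-1)k+1\le j\le ik$ and $0$ otherwise. A LowFER model accurately represents a TuckER model if the core tensor is reproduced exactly, equivalently if the two scores agree for all choices of embedding vectors. *)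

theory Defs
  imports Complex_Main "Jordan_Normal_Form.Matrix"
begin

(* All indices are 0-based. A core tensor of size d_e x d_r x d_e is a function W with entries
   W a b c; only the entries with a < de, b < dr, c < de are ever used. *)

type_synonym core_tensor = "nat \<Rightarrow> nat \<Rightarrow> nat \<Rightarrow> real"

definition tucker_score ::
  "nat \<Rightarrow> nat \<Rightarrow> core_tensor \<Rightarrow> real vec \<Rightarrow> real vec \<Rightarrow> real vec \<Rightarrow> real" where
  "tucker_score de dr W es r eo =
     (\<Sum>a<de. \<Sum>b<dr. \<Sum>c<de. W a b c * es $ a * r $ b * eo $ c)"

(* S^k: with 0-based i and j, the condition (i-1)k+1 <= j <= ik becomes i*k <= j < (i+1)*k. *)

definition S_mat :: "nat \<Rightarrow> nat \<Rightarrow> real mat" where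
  "S_mat de k = mat de (k * de) (\<lambda>(i, j). if i * k \<le> j \<and> j < (i + 1) * k then 1 else 0)"

definition diag_of_vec :: "real vec \<Rightarrow> real mat" where
  "diag_of_vec v = mat_diag (dim_vec v) (\<lambda>i. v $ i)"

definition lowfer_score ::
  "nat \<Rightarrow> nat \<Rightarrow> real mat \<Rightarrow> real mat \<Rightarrow> real vec \<Rightarrow> real vec \<Rightarrow> real vec \<Rightarrow> real" where
  "lowfer_score de k U V es r eo =
     (S_mat de k *\<^sub>v (diag_of_vec (U\<^sup>T *\<^sub>v es) *\<^sub>v (V\<^sup>T *\<^sub>v r))) \<bullet> eo"

end

theory Submission
  imports Defs
begin

text \<open>Component \<open>c\<close> of the LowFER output is a sum of \<open>k\<close> products of linear forms
  in the subject and the relation, i.e. a bilinear form of rank at most \<open>k\<close>, chosen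
  independently for each \<open>c\<close>. Every \<open>de \<times> dr\<close> slice of the core tensor has rank at
  most \<open>min de dr\<close>: take coordinate functionals on the smaller side and the rows or
  columns of the slice on the other.\<close>

lemma block_index_less:
  fixes c k t n :: nat
  assumes "c < n" and "t < k"
  shows "c * k + t < k * n"
proof -
  have "c * k + t < (c + 1) * k" using assms by simp
  also have "\<dots> \<le> n * k" using assms by (intro mult_le_mono1) simp
  finally show ?thesis by (simp add: mult.commute)
qed

text \<open>The hypothesis \<open>i < n\<close> places the whole block from \<open>i * k\<close> to
  \<open>(i + 1) * k - 1\<close> inside the summation range, so the indicator keeps exactly
  \<open>k\<close> terms and none is cut off. This is how a row of \<open>S_mat\<close> acts on a
  vector.\<close>

lemma sum_indicator_block:
  fixes g :: "nat \<Rightarrow> 'a :: semiring_1"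
  assumes "i < n"
  shows "(\<Sum>j<k * n. (if i * k \<le> j \<and> j < (i + 1) * k then 1 else 0) * g j)
    = (\<Sum>t<k. g (i * k + t))"
proof -
  have "(i + 1) * k \<le> n * k"
    using assms by (intro mult_le_mono1) simp
  then have block: "{j \<in> {..<k * n}. i * k \<le> j \<and> j < (i + 1) * k} = {i * k..<i * k + k}"
    by (auto simp: algebra_simps)
  have "(\<Sum>j<k * n. (if i * k \<le> j \<and> j < (i + 1) * k then 1 else 0) * g j)
      = (\<Sum>j<k * n. if i * k \<le> j \<and> j < (i + 1) * k then g j else 0)"
    by (intro sum.cong) auto
  also have "\<dots> = (\<Sum>j = i * k..<i * k + k. g j)"
    by (simp add: sum.inter_filter [symmetric] block [simplified])
  also have "\<dots> = (\<Sum>t<k. g (i * k + t))"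
    using sum.shift_bounds_nat_ivl [of g 0 "i * k" k]
    by (simp add: atLeast0LessThan add.commute)
  finally show ?thesis .
qed

lemma diag_of_vec_mult_index:
  assumes "dim_vec w = dim_vec v" and "j < dim_vec v"
  shows "(diag_of_vec v *\<^sub>v w) $ j = v $ j * w $ j"
proof -
  have "(diag_of_vec v *\<^sub>v w) $ j = (\<Sum>l = 0..<dim_vec v. (if j = l then v $ l else 0) * w $ l)"
    using assms by (simp add: diag_of_vec_def mat_diag_def scalar_prod_def)
  also have "\<dots> = (\<Sum>l = 0..<dim_vec v. if j = l then v $ l * w $ l else 0)"
    by (intro sum.cong) auto
  finally show ?thesis
    using assms by simp
qed

lemma transpose_mult_vec_index:
  fixes M :: "'a :: semiring_0 mat"
  assumes "M \<in> carrier_mat m n" and "v \<in> carrier_vec m" and "j < n"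
  shows "(M\<^sup>T *\<^sub>v v) $ j = (\<Sum>a<m. M $$ (a, j) * v $ a)"
  using assms by (auto simp: scalar_prod_def atLeast0LessThan)

lemma S_mat_mult_index:
  assumes "v \<in> carrier_vec (k * de)" and "i < de"
  shows "(S_mat de k *\<^sub>v v) $ i = (\<Sum>t<k. v $ (i * k + t))"
  using assms sum_indicator_block [of i de k "\<lambda>j. v $ j"]
  by (simp add: S_mat_def scalar_prod_def atLeast0LessThan)

text \<open>Expanding the matrix products shows that output component \<open>c\<close> sees only the
  columns \<open>c * k + t\<close> with \<open>t < k\<close> of \<open>U\<close> and
  \<open>V\<close>. Different values of \<open>c\<close> use disjoint sets of columns, so the
  bilinear form of each slice can be prescribed separately.\<close>

lemma lowfer_score_eq_sum:
  assumes U: "U \<in> carrier_mat de (k * de)" and V: "V \<in> carrier_mat dr (k * de)"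
    and es: "es \<in> carrier_vec de" and r: "r \<in> carrier_vec dr" and eo: "eo \<in> carrier_vec de"
  shows "lowfer_score de k U V es r eo =
    (\<Sum>c<de. (\<Sum>t<k. (\<Sum>a<de. U $$ (a, c * k + t) * es $ a)
                      * (\<Sum>b<dr. V $$ (b, c * k + t) * r $ b)) * eo $ c)"
proof -
  let ?w = "diag_of_vec (U\<^sup>T *\<^sub>v es) *\<^sub>v (V\<^sup>T *\<^sub>v r)"
  have w: "?w \<in> carrier_vec (k * de)"
    using U by (intro carrier_vecI) (simp add: diag_of_vec_def mat_diag_def)
  have w_index: "?w $ j = (\<Sum>a<de. U $$ (a, j) * es $ a) * (\<Sum>b<dr. V $$ (b, j) * r $ b)"
    if "j < k * de" for j
  proof -
    have "?w $ j = (U\<^sup>T *\<^sub>v es) $ j * (V\<^sup>T *\<^sub>v r) $ j"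
      using U V that by (intro diag_of_vec_mult_index) auto
    then show ?thesis
      using transpose_mult_vec_index [OF U es that] transpose_mult_vec_index [OF V r that] by simp
  qed
  have "lowfer_score de k U V es r eo = (\<Sum>c<de. (S_mat de k *\<^sub>v ?w) $ c * eo $ c)"
    using eo by (simp add: lowfer_score_def scalar_prod_def atLeast0LessThan)
  also have "\<dots> = (\<Sum>c<de. (\<Sum>t<k. ?w $ (c * k + t)) * eo $ c)"
    using w by (intro sum.cong refl) (simp only: S_mat_mult_index lessThan_iff)
  finally show ?thesis
    by (simp add: w_index block_index_less)
qed

text \<open>Storing the \<open>t\<close>-th factors of slice \<open>c\<close> in column
  \<open>c * k + t\<close> of \<open>U\<close> and \<open>V\<close> turns both scores into the same
  finite sum, up to the order of summation. The problem is thus reduced to factoring each slice into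
  \<open>k\<close> terms.\<close>

lemma lowfer_represents_slice_factorization:
  fixes W :: core_tensor and A B :: "nat \<Rightarrow> nat \<Rightarrow> nat \<Rightarrow> real"
  assumes W: "\<And>a b c. a < de \<Longrightarrow> b < dr \<Longrightarrow> c < de \<Longrightarrow> W a b c = (\<Sum>t<k. A c a t * B c b t)"
  obtains U V where "U \<in> carrier_mat de (k * de)" and "V \<in> carrier_mat dr (k * de)"
    and "\<And>es r eo. es \<in> carrier_vec de \<Longrightarrow> r \<in> carrier_vec dr \<Longrightarrow> eo \<in> carrier_vec de \<Longrightarrow>
      lowfer_score de k U V es r eo = tucker_score de dr W es r eo"
proof -
  \<comment> \<open>A column index is decoded as \<open>j = c * k + t\<close>: for
    \<open>t < k\<close>, \<open>j div k\<close> recovers the slice \<open>c\<close> and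
    \<open>j mod k\<close> the factor \<open>t\<close>.\<close>
  define U where "U = mat de (k * de) (\<lambda>(a, j). A (j div k) a (j mod k))"
  define V where "V = mat dr (k * de) (\<lambda>(b, j). B (j div k) b (j mod k))"
  have U: "U \<in> carrier_mat de (k * de)" and V: "V \<in> carrier_mat dr (k * de)"
    by (simp_all add: U_def V_def)
  have "lowfer_score de k U V es r eo = tucker_score de dr W es r eo"
    if es: "es \<in> carrier_vec de" and r: "r \<in> carrier_vec dr" and eo: "eo \<in> carrier_vec de"
    for es r eo
  proof -
    have "lowfer_score de k U V es r eo =
      (\<Sum>c<de. (\<Sum>t<k. (\<Sum>a<de. A c a t * es $ a) * (\<Sum>b<dr. B c b t * r $ b)) * eo $ c)"
      unfolding lowfer_score_eq_sum [OF U V es r eo]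
      by (intro sum.cong refl arg_cong2 [where f = "(*)"]) (simp_all add: U_def V_def block_index_less)
    also have "\<dots> = (\<Sum>c<de. \<Sum>a<de. \<Sum>b<dr. W a b c * es $ a * r $ b * eo $ c)"
    proof (intro sum.cong refl)
      fix c assume c: "c \<in> {..<de}"
      have "(\<Sum>t<k. (\<Sum>a<de. A c a t * es $ a) * (\<Sum>b<dr. B c b t * r $ b)) * eo $ c
          = (\<Sum>t<k. \<Sum>a<de. \<Sum>b<dr. A c a t * B c b t * es $ a * r $ b * eo $ c)"
        unfolding sum_product
        unfolding sum_distrib_right
        by (simp only: ac_simps)
      also have "\<dots> = (\<Sum>a<de. \<Sum>b<dr. \<Sum>t<k. A c a t * B c b t * es $ a * r $ b * eo $ c)"
        \<comment> \<open>Two swaps carry the sum over \<open>t\<close> past \<open>a\<close> and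
          then past \<open>b\<close>, so that the innermost sum becomes an entry of
          \<open>W\<close>.\<close>
        by (subst sum.swap, rule sum.cong [OF refl], rule sum.swap)
      also have "\<dots> = (\<Sum>a<de. \<Sum>b<dr. W a b c * es $ a * r $ b * eo $ c)"
        using c by (intro sum.cong refl) (simp add: W sum_distrib_right)
      finally show "(\<Sum>t<k. (\<Sum>a<de. A c a t * es $ a) * (\<Sum>b<dr. B c b t * r $ b)) * eo $ c
          = (\<Sum>a<de. \<Sum>b<dr. W a b c * es $ a * r $ b * eo $ c)" .
    qed
    also have "\<dots> = tucker_score de dr W es r eo"
      unfolding tucker_score_def
      by (subst sum.swap, rule sum.cong [OF refl], rule sum.swap)
    finally show ?thesis .
  qed
  with U V show thesis by (rule that)
qed

theorem proposition2:
  fixes de dr :: nat and W :: core_tensor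
  assumes "de \<ge> 1" and "dr \<ge> 1"
  shows "\<exists>k U V. 1 \<le> k \<and> k \<le> min de dr \<and>
           U \<in> carrier_mat de (k * de) \<and> V \<in> carrier_mat dr (k * de) \<and>
           (\<forall>es \<in> carrier_vec de. \<forall>r \<in> carrier_vec dr. \<forall>eo \<in> carrier_vec de.
              lowfer_score de k U V es r eo = tucker_score de dr W es r eo)"
proof -
  let ?k = "min de dr"
  have "\<exists>A B :: nat \<Rightarrow> nat \<Rightarrow> nat \<Rightarrow> real.
    \<forall>a<de. \<forall>b<dr. \<forall>c<de. W a b c = (\<Sum>t<?k. A c a t * B c b t)"
  proof (cases "de \<le> dr")
    case True
    \<comment> \<open>Here \<open>?k = de\<close>, so \<open>t\<close> runs over all subject indices
      and the sum collapses to its single term \<open>t = a\<close>.\<close>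
    then show ?thesis
      by (intro exI [of _ "\<lambda>c a t. of_bool (a = t)"] exI [of _ "\<lambda>c b t. W t b c"])
        (simp add: min_def of_bool_def if_distrib [of "\<lambda>x. x * _"] cong: if_cong)
  next
    case False
    \<comment> \<open>Now \<open>?k = dr\<close>, so \<open>t\<close> runs over all relation indices
      instead and only the term \<open>t = b\<close> survives.\<close>
    then show ?thesis
      by (intro exI [of _ "\<lambda>c a t. W a t c"] exI [of _ "\<lambda>c b t. of_bool (b = t)"])
        (simp add: min_def of_bool_def if_distrib [of "\<lambda>x. _ * x"] cong: if_cong)
  qed
  then obtain A B :: "nat \<Rightarrow> nat \<Rightarrow> nat \<Rightarrow> real"
    where "\<And>a b c. a < de \<Longrightarrow> b < dr \<Longrightarrow> c < de \<Longrightarrow> W a b c = (\<Sum>t<?k. A c a t * B c b t)"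
    by blast
  then obtain U V where "U \<in> carrier_mat de (?k * de)" and "V \<in> carrier_mat dr (?k * de)"
    and "\<And>es r eo. es \<in> carrier_vec de \<Longrightarrow> r \<in> carrier_vec dr \<Longrightarrow> eo \<in> carrier_vec de \<Longrightarrow>
      lowfer_score de ?k U V es r eo = tucker_score de dr W es r eo"
    using that by (rule lowfer_represents_slice_factorization)
  \<comment> \<open>Positivity of both dimensions gives \<open>1 \<le> ?k\<close>.\<close>
  with assms show ?thesis
    by (intro exI [of _ ?k] exI [of _ U] exI [of _ V]) auto
qed

end
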